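(* Let $f(t),g(t)\in\mathbb{C}[[t]]$ be a delta series and an invertible series respectively, let $(s_n)_{n\ge 0}$ be the Sheffer sequence for $(g(t),f(t))$, and let $r\ge 1$ be an integer. Then the Legendre-Gould Hopper based Sheffer polynomials ${}_{{}_{s}LeG^{(r)}}s_{n}(x,y,z)$ have the generating function (identity of formal power series in $t$ with coefficients in $\mathbb{C}[x,y,z]$) $$\frac{1}{g(f^{-1}(t))}\,C_0\!\left(-x\,(f^{-1}(t))^2\right)\exp\!\left(y f^{-1}(t)+z\,(f^{-1}(t))^r\right)=\sum_{n=0}^{\infty}{}_{{}_{s}LeG^{(r)}}s_{n}(x,y,z)\frac{t^n}{n!},$$ or, equivalently, with $A(t)=1/g(f^{-1}(t))$ and $H(t)=f^{-1}(t)$, $$A(t)\,C_0\!\left(-x\,(H(t))^2\right)\exp\!\left(yH(t)+z\,(H(t))^r\right)=\sum_{n=0}^{\infty}{}_{{}_{s}LeG^{(r)}}s_{n}(x,y,z)\frac{t^n}{n!}.$$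
   Context: A delta series is $f\in\mathbb{C}[[t]]$ with $f(0)=0$, $f'(0)\neq 0$; $f^{-1}$ denotes its compositional inverse. An invertible series is $g\in\mathbb{C}[[t]]$ with $g(0)\ne 0$. The Sheffer sequence for $(g,f)$ is the polynomial sequence $(s_n(x))$ with $\frac{1}{g(f^{-1}(t))}\exp(x f^{-1}(t))=\sum_{n\ge0}s_n(x)\frac{t^n}{n!}$. $C_0(x)=\sum_{k\ge 0}\frac{(-1)^k x^k}{(k!)^2}$ is the Bessel-Tricomi function of order $0$. $D_x^{-1}$ is the inverse derivative operator, $D_x^{-1}h(x)=\int_0^x h(\xi)\,d\xi$, so $D_x^{-n}\{1\}=x^n/n!$. The Legendre-Gould Hopper based Sheffer polynomials are defined by $${}_{{}_{s}LeG^{(r)}}s_{n}(x,y,z)=s_n(\hat M)\{1\},\qquad \hat M=y+2D_x^{-1}\frac{\partial}{\partial y}+rz\frac{\partial^{r-1}}{\partial y^{r-1}},$$ i.e. the polynomial $s_n$ is evaluated at the operator $\hat M$ acting on $\mathbb{C}[x,y,z]$, and the result is applied to the constant polynomial $1$. *)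

theory Defs
  imports "HOL-Complex_Analysis.Complex_Analysis"
begin

definition fps_map :: "('a \<Rightarrow> 'b) \<Rightarrow> 'a fps \<Rightarrow> 'b fps" where
  "fps_map h F = Abs_fps (\<lambda>n. h (fps_nth F n))"

definition delta_series :: "complex fps \<Rightarrow> bool" where
  "delta_series f \<longleftrightarrow> fps_nth f 0 = 0 \<and> fps_nth f 1 \<noteq> 0"

definition invertible_series :: "complex fps \<Rightarrow> bool" where
  "invertible_series g \<longleftrightarrow> fps_nth g 0 \<noteq> 0"

text \<open>
  Sheffer sequences: an identity of power series in \<open>t\<close> over \<open>\<complex>[x] = complex poly\<close>. Complex
  series are embedded coefficientwise, \<open>[:0, 1:]\<close> is \<open>x\<close>, and \<open>exp(F)\<close>, for \<open>F\<close> without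
  constant term, is the composition of the exponential series with \<open>F\<close>.
\<close>

definition sheffer_sequence :: "complex fps \<Rightarrow> complex fps \<Rightarrow> (nat \<Rightarrow> complex poly) \<Rightarrow> bool" where
  "sheffer_sequence g f s \<longleftrightarrow>
     fps_map (\<lambda>c. [:c:]) (inverse (g oo fps_inv f)) *
       (fps_map (\<lambda>c. [:c:]) (fps_exp 1) oo
         (fps_const [:0, 1:] * fps_map (\<lambda>c. [:c:]) (fps_inv f)))
     = Abs_fps (\<lambda>n. smult (1 / fact n) (s n))"

lemma sheffer_sequence_unique: "\<exists>!s. sheffer_sequence g f s"
proof -
  define G where "G =
     fps_map (\<lambda>c. [:c:]) (inverse (g oo fps_inv f)) *
       (fps_map (\<lambda>c. [:c:]) (fps_exp 1) oo
         (fps_const [:0, 1:] * fps_map (\<lambda>c. [:c:]) (fps_inv f)))"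
  have "sheffer_sequence g f s \<longleftrightarrow> (\<forall>n. fps_nth G n = smult (1 / fact n) (s n))" for s
    unfolding sheffer_sequence_def G_def[symmetric] by (simp add: fps_eq_iff)
  moreover have "p = smult (1 / fact n) q \<longleftrightarrow> q = smult (fact n) p" for p q :: "complex poly" and n
    by auto
  ultimately have "sheffer_sequence g f s \<longleftrightarrow> s = (\<lambda>n. smult (fact n) (fps_nth G n))" for s
    by (simp add: fun_eq_iff)
  thus ?thesis by simp
qed

definition bessel_tricomi_0 :: "complex fps" where
  "bessel_tricomi_0 = Abs_fps (\<lambda>k. (-1) ^ k / (fact k)\<^sup>2)"

text \<open>
  The ring \<open>\<complex>[x,y,z]\<close> is represented as \<open>\<complex>[x][y][z]\<close>: \<open>x\<close> is the variable of the innermost,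
  \<open>z\<close> the variable of the outermost polynomial layer.
\<close>

type_synonym cpoly3 = "complex poly poly poly"

definition const3 :: "complex \<Rightarrow> cpoly3" where "const3 c = [:[:[:c:]:]:]"
definition varx :: cpoly3 where "varx = [:[:[:0, 1:]:]:]"
definition vary :: cpoly3 where "vary = [:[:0, 1:]:]"
definition varz :: cpoly3 where "varz = [:0, 1:]"

definition poly_int0 :: "complex poly \<Rightarrow> complex poly" where
  "poly_int0 p = (\<Sum>i\<le>degree p. monom (coeff p i / of_nat (Suc i)) (Suc i))"

definition Dx_inv :: "cpoly3 \<Rightarrow> cpoly3" where
  "Dx_inv = map_poly (map_poly poly_int0)"

definition Dy :: "cpoly3 \<Rightarrow> cpoly3" where
  "Dy = map_poly pderiv"

lemma coeff_poly_int0: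
  "coeff (poly_int0 p) n = (case n of 0 \<Rightarrow> 0 | Suc i \<Rightarrow> coeff p i / of_nat (Suc i))"
proof (cases n)
  case (Suc m)
  have "coeff (poly_int0 p) n = (\<Sum>i\<le>degree p. if i = m then coeff p i / of_nat (Suc i) else 0)"
    unfolding poly_int0_def coeff_sum by (rule sum.cong) (auto simp: Suc)
  also have "\<dots> = coeff p m / of_nat (Suc m)"
    by (subst sum.delta) (auto simp: coeff_eq_0 not_le)
  finally show ?thesis by (simp add: Suc)
qed (simp add: poly_int0_def coeff_sum)

lemma poly_int0_0 [simp]: "poly_int0 0 = 0"
  by (simp add: poly_int0_def)

lemma pderiv_poly_int0: "pderiv (poly_int0 p) = p"
  by (rule poly_eqI) (simp add: coeff_pderiv coeff_poly_int0 del: of_nat_Suc)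

text \<open>\<open>poly_int0\<close> is the integral \<open>h(x) \<mapsto> \<integral>\<^sub>0\<^sup>x h(\<xi>) d\<xi>\<close>.\<close>

lemma poly_int0_has_contour_integral:
  "(poly p has_contour_integral poly (poly_int0 p) w) (linepath 0 w)"
proof -
  have "(poly p has_contour_integral
      (poly (poly_int0 p) (pathfinish (linepath 0 w)) - poly (poly_int0 p) (pathstart (linepath 0 w))))
      (linepath 0 w)"
    by (rule contour_integral_primitive[where S = UNIV])
      (use poly_DERIV[of "poly_int0 p"] in
        \<open>simp_all only: pderiv_poly_int0 valid_path_linepath subset_UNIV\<close>)
  moreover have "poly (poly_int0 p) 0 = 0"
    by (simp add: poly_0_coeff_0 coeff_poly_int0)
  ultimately show ?thesis by simp
qed

lemma poly_int0_funpow_1: "(poly_int0 ^^ n) 1 = monom (1 / fact n) n"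
proof (induction n)
  case (Suc n)
  show ?case
    by (rule poly_eqI) (auto simp: Suc coeff_poly_int0 field_simps split: nat.splits)
qed auto

lemma coeff_Dx_inv:
  "coeff (coeff (coeff (Dx_inv p) k) j) i =
     (case i of 0 \<Rightarrow> 0 | Suc i' \<Rightarrow> coeff (coeff (coeff p k) j) i' / of_nat (Suc i'))"
  by (simp add: Dx_inv_def coeff_map_poly coeff_poly_int0)

lemma coeff_Dy:
  "coeff (coeff (coeff (Dy p) k) j) i = of_nat (Suc j) * coeff (coeff (coeff p k) (Suc j)) i"
  by (simp add: Dy_def coeff_map_poly coeff_pderiv of_nat_poly del: of_nat_Suc)

definition LeG_operator :: "nat \<Rightarrow> cpoly3 \<Rightarrow> cpoly3" where
  "LeG_operator r p =
     vary * p + 2 * Dx_inv (Dy p) + const3 (of_nat r) * varz * (Dy ^^ (r - 1)) p"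

text \<open>The value \<open>s(T){v}\<close> of a polynomial \<open>s\<close> at an operator \<open>T\<close>, applied to \<open>v\<close>.\<close>

definition poly_at_operator :: "complex poly \<Rightarrow> (cpoly3 \<Rightarrow> cpoly3) \<Rightarrow> cpoly3 \<Rightarrow> cpoly3" where
  "poly_at_operator s T v = (\<Sum>k\<le>degree s. const3 (coeff s k) * (T ^^ k) v)"

definition LeG_sheffer :: "nat \<Rightarrow> (nat \<Rightarrow> complex poly) \<Rightarrow> nat \<Rightarrow> cpoly3" where
  "LeG_sheffer r s n = poly_at_operator (s n) (LeG_operator r) 1"

end

theory Submission
  imports Defs
begin

text \<open>
  Put \<open>\<Phi>(t) = C\<^sub>0(-x t\<^sup>2) exp(y t + z t\<^sup>r)\<close>. Its second factor is free of \<open>x\<close> and multiplied by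
  \<open>t\<close> under \<open>\<partial>/\<partial>y\<close>, and \<open>d/dt C\<^sub>0(-x t\<^sup>2) = 2 t D\<^sub>x\<^sup>-\<^sup>1 C\<^sub>0(-x t\<^sup>2)\<close>. Hence
  \<open>d\<Phi>/dt = M \<Phi>\<close> for the operator \<open>M\<close> of the theorem, so \<open>\<Phi>(t) = \<Sum>\<^sub>k M\<^sup>k{1} t\<^sup>k / k!\<close>.
  The Sheffer condition says that \<open>x\<^sup>k\<close> has coefficient \<open>n!/k! [t\<^sup>n] A(t) H(t)\<^sup>k\<close> in \<open>s\<^sub>n\<close>;
  therefore \<open>s\<^sub>n(M){1}/n!\<close> is the coefficient of \<open>t\<^sup>n\<close> in \<open>A(t) \<Phi>(H(t))\<close>.
\<close>

section \<open>Coefficientwise images of power series under homomorphisms\<close>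

lemma fps_nth_fps_map [simp]: "fps_nth (fps_map h F) n = h (fps_nth F n)"
  by (simp add: fps_map_def)

text \<open>Covers both embeddings of the complex numbers in play: into \<open>complex poly\<close>
  for the Sheffer condition and into \<open>cpoly3\<close> for the generating function.\<close>

locale semiring_hom =
  fixes h :: "'a::comm_semiring_1 \<Rightarrow> 'b::comm_semiring_1"
  assumes hom_0 [simp]: "h 0 = 0"
    and hom_1 [simp]: "h 1 = 1"
    and hom_add: "h (a + b) = h a + h b"
    and hom_mult: "h (a * b) = h a * h b"
begin

lemma hom_sum: "h (sum u S) = (\<Sum>i\<in>S. h (u i))"
  by (induction S rule: infinite_finite_induct) (simp_all add: hom_add)

lemma hom_of_nat: "h (of_nat n) = of_nat n"
  by (induction n) (simp_all add: hom_add)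

lemma fps_map_mult: "fps_map h (F * G) = fps_map h F * fps_map h G"
  by (rule fps_ext) (simp add: fps_mult_nth hom_sum hom_mult)

lemma fps_map_power: "fps_map h (F ^ n) = fps_map h F ^ n"
proof (induction n)
  case 0
  show ?case by (rule fps_ext) simp
next
  case (Suc n)
  then show ?case by (simp add: fps_map_mult)
qed

lemma fps_deriv_fps_map: "fps_deriv (fps_map h F) = fps_map h (fps_deriv F)"
  by (rule fps_ext) (simp add: hom_mult hom_of_nat del: of_nat_Suc)

end

interpretation const_poly: semiring_hom "\<lambda>c::complex. [:c:]"
  by unfold_locales simp_all

interpretation const3: semiring_hom const3
  by unfold_locales (simp_all add: const3_def pCons_one)

section \<open>Coefficients of Sheffer polynomials and their values at the operator\<close>

text \<open>As \<open>H\<close> has no constant term, \<open>H ^ i\<close> starts in degree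
  \<open>i\<close> or later, so every coefficient up to degree \<open>n\<close> can use the same
  range \<open>i \<le> n\<close> and the sums can be swapped. Applied with \<open>c\<close> the
  variable x for the Sheffer condition and with \<open>c = 1\<close> for the operator
  series.\<close>

lemma fps_mult_compose_nth:
  fixes A F H :: "'a::comm_ring_1 fps"
  assumes "fps_nth H 0 = 0"
  shows "fps_nth (A * (F oo (fps_const c * H))) n =
    (\<Sum>i\<le>n. fps_nth F i * c ^ i * fps_nth (A * H ^ i) n)"
proof -
  have *: "fps_nth (F oo (fps_const c * H)) m = (\<Sum>i\<le>n. fps_nth F i * c ^ i * fps_nth (H ^ i) m)"
    if "m \<le> n" for m
  proof -
    have "fps_nth (F oo (fps_const c * H)) m = (\<Sum>i\<le>m. fps_nth F i * c ^ i * fps_nth (H ^ i) m)"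
      by (simp add: fps_compose_nth power_mult_distrib mult.assoc atLeast0AtMost)
    also have "\<dots> = (\<Sum>i\<le>n. fps_nth F i * c ^ i * fps_nth (H ^ i) m)"
      by (rule sum.mono_neutral_left)
        (use that startsby_zero_power_prefix[OF assms] in auto)
    finally show ?thesis .
  qed
  have "fps_nth (A * (F oo (fps_const c * H))) n =
      (\<Sum>j=0..n. \<Sum>i\<le>n. fps_nth A j * (fps_nth F i * c ^ i * fps_nth (H ^ i) (n - j)))"
    by (simp add: fps_mult_nth * sum_distrib_left)
  also have "\<dots> = (\<Sum>i\<le>n. \<Sum>j=0..n. fps_nth A j * (fps_nth F i * c ^ i * fps_nth (H ^ i) (n - j)))"
    by (rule sum.swap)
  also have "\<dots> = (\<Sum>i\<le>n. fps_nth F i * c ^ i * fps_nth (A * H ^ i) n)"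
    by (simp add: fps_mult_nth sum_distrib_left mult_ac)
  finally show ?thesis .
qed

lemma fps_inv_nth_0 [simp]: "fps_nth (fps_inv f) 0 = 0"
  by (simp add: fps_inv_def)

lemma coeff_sheffer_sequence:
  assumes "sheffer_sequence g f s"
  shows "coeff (s n) k =
    (if k \<le> n then fact n / fact k * fps_nth (inverse (g oo fps_inv f) * fps_inv f ^ k) n else 0)"
proof -
  let ?A = "inverse (g oo fps_inv f)" and ?H = "fps_inv f"
  \<comment> \<open>Merging \<open>A * H ^ i\<close> under one embedding makes its coefficients
    constants, so all dependence on x sits in the explicit powers of
    \<open>[:0, 1:]\<close>.\<close>
  have "smult (1 / fact n) (s n) =
      (\<Sum>i\<le>n. [:1 / fact i:] * [:0, 1:] ^ i * [:fps_nth (?A * ?H ^ i) n:])"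
    using assms
    by (simp add: sheffer_sequence_def fps_eq_iff fps_mult_compose_nth
        flip: const_poly.fps_map_power const_poly.fps_map_mult)
  also have "\<dots> = (\<Sum>i\<le>n. monom (fps_nth (?A * ?H ^ i) n / fact i) i)"
    by (rule sum.cong) (simp_all add: monom_altdef)
  finally have "coeff (smult (1 / fact n) (s n)) k =
      coeff (\<Sum>i\<le>n. monom (fps_nth (?A * ?H ^ i) n / fact i) i) k"
    by simp
  then show ?thesis
    by (auto simp: coeff_sum field_simps split: if_splits)
qed

text \<open>Reduces the theorem to finding a closed form for the exponential generating function of
  the iterates of \<open>LeG_operator r\<close> on 1, which no longer involves \<open>f\<close> and
  \<open>g\<close>.\<close>

lemma sum_LeG_sheffer:
  assumes "sheffer_sequence g f s"
  shows "const3 (1 / fact n) * LeG_sheffer r s n =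
    fps_nth (fps_map const3 (inverse (g oo fps_inv f)) *
      (Abs_fps (\<lambda>k. const3 (1 / fact k) * (LeG_operator r ^^ k) 1) oo fps_map const3 (fps_inv f))) n"
proof -
  let ?A = "inverse (g oo fps_inv f)" and ?H = "fps_inv f"
  let ?E = "Abs_fps (\<lambda>k. const3 (1 / fact k) * (LeG_operator r ^^ k) 1)"
  have "degree (s n) \<le> n"
    by (rule degree_le) (simp add: coeff_sheffer_sequence[OF assms])
  then have "LeG_sheffer r s n = (\<Sum>k\<le>n. const3 (coeff (s n) k) * (LeG_operator r ^^ k) 1)"
    unfolding LeG_sheffer_def poly_at_operator_def
    by (intro sum.mono_neutral_left) (auto simp: coeff_eq_0)
  then have "const3 (1 / fact n) * LeG_sheffer r s n =
      (\<Sum>k\<le>n. const3 (1 / fact n * coeff (s n) k) * (LeG_operator r ^^ k) 1)"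
    by (simp only: sum_distrib_left const3.hom_mult mult.assoc)
  also have "\<dots> = (\<Sum>k\<le>n. const3 (1 / fact k * fps_nth (?A * ?H ^ k) n) * (LeG_operator r ^^ k) 1)"
    by (rule sum.cong) (simp_all add: coeff_sheffer_sequence[OF assms])
  also have "\<dots> = (\<Sum>k\<le>n. fps_nth ?E k * 1 ^ k * fps_nth (fps_map const3 ?A * fps_map const3 ?H ^ k) n)"
    by (rule sum.cong)
      (simp_all only: const3.hom_mult fps_nth_Abs_fps fps_nth_fps_map power_one mult_1_left mult_1_right mult_ac
        flip: const3.fps_map_power const3.fps_map_mult)
  also have "\<dots> = fps_nth (fps_map const3 ?A * (?E oo fps_map const3 ?H)) n"
    using fps_mult_compose_nth[of "fps_map const3 ?H" "fps_map const3 ?A" ?E 1 n] by simp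
  finally show ?thesis .
qed

section \<open>Algebraic rules for \<open>Dx_inv\<close> and \<open>Dy\<close>\<close>

lemma Dx_inv_0 [simp]: "Dx_inv 0 = 0"
  by (simp add: Dx_inv_def)

lemma Dx_inv_add: "Dx_inv (p + q) = Dx_inv p + Dx_inv q"
  by (intro poly_eqI) (simp add: coeff_Dx_inv add_divide_distrib split: nat.split)

lemma Dx_inv_sum: "Dx_inv (sum u S) = (\<Sum>i\<in>S. Dx_inv (u i))"
  by (induction S rule: infinite_finite_induct) (simp_all add: Dx_inv_add)

lemma Dx_inv_const3_mult: "Dx_inv (const3 c * p) = const3 c * Dx_inv p"
  by (intro poly_eqI) (simp add: const3_def coeff_Dx_inv split: nat.split)

lemma Dx_inv_vary_mult: "Dx_inv (vary * p) = vary * Dx_inv p"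
  by (intro poly_eqI) (simp add: vary_def coeff_Dx_inv coeff_pCons split: nat.split)

lemma Dx_inv_varz_mult: "Dx_inv (varz * p) = varz * Dx_inv p"
  by (intro poly_eqI) (simp add: varz_def coeff_Dx_inv coeff_pCons split: nat.split)

lemma varx_power: "varx ^ k = [:[:monom 1 k:]:]"
  by (induction k) (simp_all add: varx_def monom_Suc pCons_one)

lemma Dx_inv_varx_power: "Dx_inv (varx ^ k) = const3 (1 / of_nat (Suc k)) * varx ^ Suc k"
  unfolding varx_power const3_def
  by (intro poly_eqI)
    (simp add: coeff_Dx_inv coeff_pCons split: nat.split del: of_nat_Suc)

lemma Dy_0 [simp]: "Dy 0 = 0"
  by (simp add: Dy_def)

lemma Dy_add: "Dy (p + q) = Dy p + Dy q"
  by (intro poly_eqI) (simp add: coeff_Dy algebra_simps)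

lemma Dy_sum: "Dy (sum u S) = (\<Sum>i\<in>S. Dy (u i))"
  by (induction S rule: infinite_finite_induct) (simp_all add: Dy_add)

text \<open>\<open>Dy\<close> differentiates each coefficient of the outer variable, so the product
  rule for \<open>pderiv\<close> applies to every term of the convolution.\<close>

lemma Dy_mult: "Dy (p * q) = Dy p * q + p * Dy q"
proof (rule poly_eqI)
  have pderiv_sum: "pderiv (sum u S) = (\<Sum>i\<in>S. pderiv (u i))" for u :: "nat \<Rightarrow> complex poly poly" and S
    by (induction S rule: infinite_finite_induct) (simp_all add: pderiv_add)
  have pderiv_mult': "pderiv (a * b) = pderiv a * b + a * pderiv b" for a b :: "complex poly poly"
    by (simp add: pderiv_mult)
  show "coeff (Dy (p * q)) n = coeff (Dy p * q + p * Dy q) n" for n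
    by (simp add: Dy_def coeff_map_poly coeff_mult pderiv_sum pderiv_mult' sum.distrib)
qed

lemma Dy_const3 [simp]: "Dy (const3 c) = 0"
  and Dy_varx [simp]: "Dy varx = 0"
  and Dy_vary [simp]: "Dy vary = 1"
  and Dy_varz [simp]: "Dy varz = 0"
  by (simp_all add: Dy_def const3_def varx_def vary_def varz_def map_poly_pCons map_poly_1 pderiv_pCons pCons_one)

lemma Dy_1 [simp]: "Dy 1 = 0"
  by (metis Dy_const3 const3.hom_1)

lemma Dy_of_nat [simp]: "Dy (of_nat n) = 0"
  by (metis Dy_const3 const3.hom_of_nat)

lemma Dy_varx_power [simp]: "Dy (varx ^ n) = 0"
  by (induction n) (simp_all add: Dy_mult)

lemma fps_map_Dy_mult: "fps_map Dy (F * G) = fps_map Dy F * G + F * fps_map Dy G"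
  by (rule fps_ext) (simp add: fps_mult_nth Dy_sum Dy_mult sum.distrib)

lemma fps_deriv_fps_map_Dy: "fps_deriv (fps_map Dy F) = fps_map Dy (fps_deriv F)"
  by (rule fps_ext) (simp add: Dy_mult del: of_nat_Suc)

text \<open>The equation expresses \<open>n\<close> times the coefficient \<open>n\<close> through
  earlier coefficients, so strong induction gives zero; characteristic 0 permits cancelling
  \<open>n\<close>.\<close>

lemma fps_linear_ode_unique:
  fixes W P :: "'a::{idom,ring_char_0} fps"
  assumes "fps_deriv W = P * W" and "fps_nth W 0 = 0"
  shows "W = 0"
proof (rule fps_ext)
  show "fps_nth W n = fps_nth 0 n" for n
  proof (induction n rule: less_induct)
    case (less n)
    show ?case
    proof (cases n)
      case (Suc m)
      have "of_nat n * fps_nth W n = fps_nth (P * W) m"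
        using assms(1) by (simp add: Suc fps_eq_iff del: of_nat_Suc)
      also have "\<dots> = 0"
        using less by (simp add: fps_mult_nth Suc)
      finally show ?thesis
        by (simp add: Suc del: of_nat_Suc)
    qed (use assms in simp)
  qed
qed

section \<open>The Bessel and exponential factors\<close>

text \<open>Both factors are studied in t itself; \<open>fps_inv f\<close> is substituted only in
  the final proof.\<close>

definition bessel_part :: "cpoly3 fps" where
  "bessel_part = fps_map const3 bessel_tricomi_0 oo (- fps_const varx * fps_X ^ 2)"

definition exp_part :: "nat \<Rightarrow> cpoly3 fps" where
  "exp_part r = fps_map const3 (fps_exp 1) oo (fps_const vary * fps_X + fps_const varz * fps_X ^ r)"

text \<open>The signs of the Bessel-Tricomi series cancel those of the powers of
  \<open>- varx\<close>.\<close>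

lemma bessel_part_nth:
  "fps_nth bessel_part n = (if even n then const3 (1 / (fact (n div 2))\<^sup>2) * varx ^ (n div 2) else 0)"
proof -
  have *: "(- fps_const varx * fps_X ^ 2) ^ i = fps_const ((- varx) ^ i) * fps_X ^ (2 * i)" for i
    by (simp only: fps_const_neg power_mult_distrib fps_const_power power_mult)
  have "fps_nth bessel_part n =
      (\<Sum>i=0..n. if n = 2 * i then const3 ((-1) ^ i / (fact i)\<^sup>2) * (- varx) ^ i else 0)"
    unfolding bessel_part_def fps_compose_nth bessel_tricomi_0_def *
    by (intro sum.cong) simp_all
  also have "\<dots> = (\<Sum>i=0..n. if even n \<and> i = n div 2 then const3 (1 / (fact i)\<^sup>2) * varx ^ i else 0)"
  proof (rule sum.cong)
    have "const3 ((-1) ^ i / (fact i)\<^sup>2) * (- varx) ^ i = const3 (1 / (fact i)\<^sup>2) * varx ^ i" for i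
    proof -
      \<comment> \<open>\<open>semiring_hom\<close> says nothing about negation, so the sign comes
        from the definition of \<open>const3\<close>.\<close>
      have "const3 (-1) = - const3 1"
        by (simp only: const3_def minus_pCons minus_zero)
      then have "const3 ((-1) ^ i) = (-1) ^ i"
        by (induction i) (simp_all only: power_0 power_Suc const3.hom_mult const3.hom_1)
      then have "const3 ((-1) ^ i / (fact i)\<^sup>2) * (- varx) ^ i =
          const3 ((-1) ^ i * ((-1) ^ i / (fact i)\<^sup>2)) * varx ^ i"
        by (simp only: const3.hom_mult power_minus[of varx] mult_ac)
      then show ?thesis
        by (simp flip: power_mult_distrib)
    qed
    then show "(if n = 2 * i then const3 ((-1) ^ i / (fact i)\<^sup>2) * (- varx) ^ i else 0) =
        (if even n \<and> i = n div 2 then const3 (1 / (fact i)\<^sup>2) * varx ^ i else 0)" for i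
      by auto
  qed simp
  also have "\<dots> = (if even n then const3 (1 / (fact (n div 2))\<^sup>2) * varx ^ (n div 2) else 0)"
    by simp
  finally show ?thesis .
qed

lemma fps_map_Dy_bessel_part: "fps_map Dy bessel_part = 0"
  by (rule fps_ext) (simp add: bessel_part_nth Dy_mult)

text \<open>In degree \<open>2 * k + 1\<close> this is 2(k+1)/((k+1)!)^2 = 2/((k+1)(k!)^2), the
  factor 1/(k+1) coming from integrating x^k. In even degrees both sides vanish.\<close>

lemma fps_deriv_bessel_part: "fps_deriv bessel_part = 2 * (fps_X * fps_map Dx_inv bessel_part)"
proof (rule fps_ext)
  fix n
  show "fps_nth (fps_deriv bessel_part) n = fps_nth (2 * (fps_X * fps_map Dx_inv bessel_part)) n"
  proof (cases "odd n")
    case True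
    then obtain k where n: "n = 2 * k + 1"
      by (rule oddE)
    have "fps_nth bessel_part (n + 1) = const3 (1 / (fact (Suc k))\<^sup>2) * varx ^ Suc k"
      by (simp add: n bessel_part_nth del: fact_Suc)
    then have "fps_nth (fps_deriv bessel_part) n =
        const3 (of_nat (n + 1)) * (const3 (1 / (fact (Suc k))\<^sup>2) * varx ^ Suc k)"
      by (simp only: fps_deriv_nth const3.hom_of_nat)
    also have "\<dots> = const3 (of_nat (n + 1) * (1 / (fact (Suc k))\<^sup>2)) * varx ^ Suc k"
      by (simp only: const3.hom_mult mult.assoc)
    also have "of_nat (n + 1) * (1 / (fact (Suc k))\<^sup>2) =
        2 * (1 / (fact k)\<^sup>2) * (1 / of_nat (Suc k) :: complex)"
    proof -
      have "of_nat (n + 1) = (2 * of_nat (Suc k) :: complex)" by (simp add: n)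
      then show ?thesis
        by (simp add: power2_eq_square del: of_nat_Suc of_nat_add)
    qed
    also have "const3 \<dots> * varx ^ Suc k = 2 * Dx_inv (const3 (1 / (fact k)\<^sup>2) * varx ^ k)"
    proof -
      have "const3 2 = 2" using const3.hom_of_nat[of 2] by simp
      then show ?thesis
        by (simp only: Dx_inv_const3_mult Dx_inv_varx_power const3.hom_mult mult.assoc)
    qed
    also have "\<dots> = fps_nth (2 * (fps_X * fps_map Dx_inv bessel_part)) n"
      by (simp add: n bessel_part_nth numeral_fps_const)
    finally show ?thesis .
  qed (auto simp: bessel_part_nth numeral_fps_const)
qed

lemma fps_deriv_exp_part:
  assumes "r \<ge> 1"
  shows "fps_deriv (exp_part r) =
    (fps_const vary + fps_const (const3 (of_nat r) * varz) * fps_X ^ (r - 1)) * exp_part r"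
proof -
  have "fps_deriv (fps_map const3 (fps_exp 1)) = fps_map const3 (fps_exp 1)"
    by (simp add: const3.fps_deriv_fps_map)
  with assms show ?thesis
    by (simp add: exp_part_def fps_compose_deriv fps_deriv_power const3.hom_of_nat fps_of_nat
        mult_ac flip: fps_const_mult)
qed

text \<open>With E the exponential factor and E' = P E, both sides solve W' = P W + E with W(0) = 0,
  so their difference solves the homogeneous equation and vanishes.\<close>

lemma fps_map_Dy_exp_part:
  assumes "r \<ge> 1"
  shows "fps_map Dy (exp_part r) = fps_X * exp_part r"
proof -
  define P where "P = fps_const vary + fps_const (const3 (of_nat r) * varz) * fps_X ^ (r - 1)"
  note deriv = fps_deriv_exp_part[OF assms, folded P_def]
  \<comment> \<open>The only occurrence of y in \<open>P\<close> is the summand \<open>vary\<close>;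
    this produces the inhomogeneous term E.\<close>
  have Dy_P: "fps_map Dy P = 1"
    by (rule fps_ext) (auto simp: P_def Dy_add Dy_mult)
  have "fps_map Dy (exp_part r) - fps_X * exp_part r = 0"
  proof (rule fps_linear_ode_unique)
    show "fps_deriv (fps_map Dy (exp_part r) - fps_X * exp_part r) =
        P * (fps_map Dy (exp_part r) - fps_X * exp_part r)"
      by (simp add: fps_deriv_fps_map_Dy deriv fps_map_Dy_mult Dy_P algebra_simps)
    show "fps_nth (fps_map Dy (exp_part r) - fps_X * exp_part r) 0 = 0"
      by (simp add: exp_part_def)
  qed
  then show ?thesis by simp
qed

text \<open>The elements that commute with \<^const>\<open>Dx_inv\<close> form a subring, which contains the
  coefficients of the exponential factor because they do not involve \<open>x\<close>.\<close>

lemma Dx_inv_exp_part_mult: "Dx_inv (fps_nth (exp_part r) n * q) = fps_nth (exp_part r) n * Dx_inv q"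
proof -
  define S where "S = {p. \<forall>q. Dx_inv (p * q) = p * Dx_inv q}"
  have add: "a + b \<in> S" and mult: "a * b \<in> S" if "a \<in> S" "b \<in> S" for a b
    using that by (simp_all add: S_def Dx_inv_add distrib_right mult.assoc)
  have const3: "const3 c \<in> S" for c
    by (simp add: S_def Dx_inv_const3_mult)
  have zero: "0 \<in> S" and one: "1 \<in> S"
    by (simp_all add: S_def)
  have sum: "sum u I \<in> S" if "\<And>i. u i \<in> S" for u :: "nat \<Rightarrow> cpoly3" and I
    using that by (induction I rule: infinite_finite_induct) (auto intro: zero add)
  have arg: "fps_nth (fps_const vary * fps_X + fps_const varz * fps_X ^ r) m \<in> S" for m
    by (auto simp: S_def Dx_inv_vary_mult Dx_inv_varz_mult Dx_inv_add distrib_right)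
  have "fps_nth ((fps_const vary * fps_X + fps_const varz * fps_X ^ r) ^ i) m \<in> S" for i m
  proof (induction i arbitrary: m)
    case (Suc i)
    then show ?case
      unfolding power_Suc fps_mult_nth by (intro sum mult arg)
  qed (simp add: zero one)
  then have "fps_nth (exp_part r) n \<in> S"
    unfolding exp_part_def fps_compose_nth by (intro sum mult) (simp add: const3)
  then show ?thesis by (simp add: S_def)
qed

section \<open>The differential equation in t and its solution\<close>

text \<open>By the product rule, the Bessel factor yields the integral term of the operator and the
  exponential factor yields the other two, since \<open>Dy\<close> acts on the product as
  multiplication by t.\<close>

lemma fps_deriv_bessel_exp:
  assumes "r \<ge> 1"
  shows "fps_deriv (bessel_part * exp_part r) = fps_map (LeG_operator r) (bessel_part * exp_part r)"
proof -
  let ?F = "bessel_part * exp_part r"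
  have Dy: "fps_map Dy ?F = fps_X * ?F"
    by (simp add: fps_map_Dy_mult fps_map_Dy_bessel_part fps_map_Dy_exp_part[OF assms])
  have Dy_power: "fps_map (Dy ^^ k) ?F = fps_X ^ k * ?F" for k
  proof (induction k)
    case (Suc k)
    have "fps_map (Dy ^^ Suc k) ?F = fps_map Dy (fps_map (Dy ^^ k) ?F)"
      by (rule fps_ext) simp
    also have "\<dots> = fps_X ^ Suc k * ?F"
    proof -
      have "fps_map Dy (fps_X ^ k) = 0"
        by (rule fps_ext) simp
      then show ?thesis
        by (simp only: Suc fps_map_Dy_mult[of "fps_X ^ k" ?F] Dy) (simp add: mult_ac)
    qed
    finally show ?case .
  qed (simp add: fps_map_def fps_eq_iff)
  have "fps_map Dx_inv ?F = fps_map Dx_inv bessel_part * exp_part r"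
  proof (rule fps_ext)
    have *: "Dx_inv (p * fps_nth (exp_part r) n) = Dx_inv p * fps_nth (exp_part r) n" for p n
      using Dx_inv_exp_part_mult[of r n p] by (simp only: mult.commute)
    show "fps_nth (fps_map Dx_inv ?F) n = fps_nth (fps_map Dx_inv bessel_part * exp_part r) n" for n
      by (simp add: fps_mult_nth Dx_inv_sum *)
  qed
  moreover have "fps_map (\<lambda>p. Dx_inv (Dy p)) ?F = fps_X * fps_map Dx_inv ?F"
  proof -
    have "fps_map (\<lambda>p. Dx_inv (Dy p)) ?F = fps_map Dx_inv (fps_map Dy ?F)"
      by (rule fps_ext) simp
    also have "\<dots> = fps_X * fps_map Dx_inv ?F"
      by (rule fps_ext) (simp add: Dy)
    finally show ?thesis .
  qed
  moreover have "fps_map (LeG_operator r) ?F =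
      fps_const vary * ?F + 2 * fps_map (\<lambda>p. Dx_inv (Dy p)) ?F +
      fps_const (const3 (of_nat r) * varz) * fps_map (Dy ^^ (r - 1)) ?F"
    by (rule fps_ext) (simp add: LeG_operator_def numeral_fps_const)
  ultimately have "fps_map (LeG_operator r) ?F =
      fps_const vary * ?F + 2 * (fps_X * (fps_map Dx_inv bessel_part * exp_part r)) +
      fps_const (const3 (of_nat r) * varz) * (fps_X ^ (r - 1) * ?F)"
    by (simp only: Dy_power)
  then show ?thesis
    by (simp add: fps_deriv_bessel_part fps_deriv_exp_part[OF assms] algebra_simps)
qed

text \<open>Lets the scalar 1/n! pass through the operator in the recursion for the
  coefficients.\<close>

lemma LeG_operator_const3_mult: "LeG_operator r (const3 c * p) = const3 c * LeG_operator r p"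
proof -
  have "(Dy ^^ k) (const3 c * p) = const3 c * (Dy ^^ k) p" for k
    by (induction k) (simp_all add: Dy_mult)
  then show ?thesis
    by (simp add: LeG_operator_def Dy_mult Dx_inv_const3_mult) (simp add: algebra_simps)
qed

text \<open>In degree n the differential equation says that (n+1) times the next coefficient is the
  operator applied to the current one; the recursion starts from 1.\<close>

lemma bessel_exp_eq:
  assumes "r \<ge> 1"
  shows "bessel_part * exp_part r = Abs_fps (\<lambda>k. const3 (1 / fact k) * (LeG_operator r ^^ k) 1)"
proof (rule fps_ext)
  let ?F = "bessel_part * exp_part r"
  have "fps_nth ?F n = const3 (1 / fact n) * (LeG_operator r ^^ n) 1" for n
  proof (induction n)
    case 0
    show ?case
      by (simp add: bessel_part_nth exp_part_def)
  next
    case (Suc n)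
    have "of_nat (Suc n) * fps_nth ?F (Suc n) = LeG_operator r (fps_nth ?F n)"
      using arg_cong[OF fps_deriv_bessel_exp[OF assms], of "\<lambda>F. fps_nth F n"]
      by (simp only: fps_deriv_nth fps_nth_fps_map Suc_eq_plus1)
    also have "\<dots> = const3 (1 / fact n) * (LeG_operator r ^^ Suc n) 1"
      by (simp only: Suc LeG_operator_const3_mult funpow.simps o_apply)
    \<comment> \<open>Exposes the factor n+1 that is cancelled against the left-hand side.\<close>
    also have "(1 / fact n :: complex) = of_nat (Suc n) * (1 / fact (Suc n))"
      by (simp del: of_nat_Suc)
    finally show ?case
      by (simp only: const3.hom_mult const3.hom_of_nat mult.assoc mult_cancel_left of_nat_eq_0_iff)
        simp
  qed
  then show "fps_nth ?F n = fps_nth (Abs_fps (\<lambda>k. const3 (1 / fact k) * (LeG_operator r ^^ k) 1)) n" for n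
    by simp
qed

theorem theorem2p1:
  fixes f g :: "complex fps" and s :: "nat \<Rightarrow> complex poly" and r :: nat
  assumes "delta_series f" and "invertible_series g"
    and "sheffer_sequence g f s"
    and "r \<ge> 1"
  shows
    "(fps_map const3 (inverse (g oo fps_inv f)) *
        (fps_map const3 bessel_tricomi_0 oo
          (- fps_const varx * (fps_map const3 (fps_inv f)) ^ 2)) *
        (fps_map const3 (fps_exp 1) oo
          (fps_const vary * fps_map const3 (fps_inv f) +
           fps_const varz * (fps_map const3 (fps_inv f)) ^ r))
      = Abs_fps (\<lambda>n. const3 (1 / fact n) * LeG_sheffer r s n))
     \<and>
     (\<forall>A H. A = inverse (g oo fps_inv f) \<longrightarrow> H = fps_inv f \<longrightarrow>
        fps_map const3 A *
          (fps_map const3 bessel_tricomi_0 oo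
            (- fps_const varx * (fps_map const3 H) ^ 2)) *
          (fps_map const3 (fps_exp 1) oo
            (fps_const vary * fps_map const3 H + fps_const varz * (fps_map const3 H) ^ r))
        = Abs_fps (\<lambda>n. const3 (1 / fact n) * LeG_sheffer r s n))"
proof -
  define A where "A = fps_map const3 (inverse (g oo fps_inv f))"
  define H where "H = fps_map const3 (fps_inv f)"
  have H0: "fps_nth H 0 = 0"
    by (simp add: H_def)
  \<comment> \<open>Associativity of composition applies because \<open>H\<close> and the inner
    series have zero constant term; for \<open>exp_part\<close> the latter uses
    \<open>r \<ge> 1\<close>.\<close>
  have "bessel_part oo H = fps_map const3 bessel_tricomi_0 oo (- fps_const varx * H ^ 2)"
    unfolding bessel_part_def
    by (subst fps_compose_assoc[symmetric])
      (simp_all add: H0 fps_compose_mult_distrib fps_compose_power[symmetric] fps_compose_uminus)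
  moreover have "exp_part r oo H =
      fps_map const3 (fps_exp 1) oo (fps_const vary * H + fps_const varz * H ^ r)"
    unfolding exp_part_def using assms(4)
    by (subst fps_compose_assoc[symmetric])
      (simp_all add: H0 fps_compose_mult_distrib fps_compose_power[symmetric] fps_compose_add_distrib)
  moreover have "(bessel_part * exp_part r) oo H = (bessel_part oo H) * (exp_part r oo H)"
    by (rule fps_compose_mult_distrib) (rule H0)
  moreover have "A * ((bessel_part * exp_part r) oo H) =
      Abs_fps (\<lambda>n. const3 (1 / fact n) * LeG_sheffer r s n)"
    unfolding bessel_exp_eq[OF assms(4)] A_def H_def
    by (rule fps_ext) (simp only: fps_nth_Abs_fps sum_LeG_sheffer[OF assms(3)])
  ultimately have "A * (fps_map const3 bessel_tricomi_0 oo (- fps_const varx * H ^ 2)) *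
      (fps_map const3 (fps_exp 1) oo (fps_const vary * H + fps_const varz * H ^ r)) =
      Abs_fps (\<lambda>n. const3 (1 / fact n) * LeG_sheffer r s n)"
    by (simp only: mult.assoc)
  then show ?thesis
    by (simp add: A_def H_def)
qed

end
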